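(* Let $I\subseteq\mathbb{R}$ be a nonempty open interval, $d\ge2$, let $f,h:I\to\mathbb{R}$ be twice continuously differentiable functions with non-vanishing first derivatives, let $\mu_0$ be a probability measure on a measurable space $(T,\mathscr{A})$, and let $m\in\mathscr{C}_2(I^d\times T)$ be a measurable family of $d$-variable means. Assume that, for all $x_0\in I$, there exists $i\in\{1,\dots,d-1\}$ such that $t\mapsto\partial_i m(\pmb{x}_0,t)$, where $\pmb{x}_0:=(x_0,\dots,x_0)$, is not $\mu_0$-almost everywhere constant on $T$. The following assertions are equivalent: (i) for all probability measures $\mu$ on $(T,\mathscr{A})$, $M_{f,1,m;\mu}(\pmb{x})\le M_{h,1,m;\mu}(\pmb{x})$ for all $\pmb{x}\in I^d$; (ii) $M_{f,1,m;\mu_0}(\pmb{x})\le M_{h,1,m;\mu_0}(\pmb{x})$ for all $\pmb{x}\in I^d$; (iii) for all $x_0\in I$, there exists a neighborhood $U\subseteq I$ of $x_0$ such that $M_{f,1,m;\mu_0}(\pmb{x})\le M_{h,1,m;\mu_0}(\pmb{x})$ for all $\pmb{x}\in U^d$; (iv) for all $x\in I$, $\dfrac{f''(x)}{f'(x)}\le\dfrac{h''(x)}{h'(x)}$; (v) the function $h\circ f^{-1}$ is convex (concave) on $f(I)$ provided that $f$ is increasing (decreasing); (vi) for all $(u,v)\in I^2$, $\dfrac{f(u)-f(v)}{f'(v)}\le\dfrac{h(u)-h(v)}{h'(v)}$.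
   Context: A function $M:I^d\to I$ is a $d$-variable mean on $I$ if $\min(\pmb{x})\le M(\pmb{x})\le\max(\pmb{x})$ for all $\pmb{x}\in I^d$. For a measurable space $(T,\mathscr{A})$, $m:I^d\times T\to I$ is a measurable family of $d$-variable means if $m(\cdot,t)$ is a $d$-variable mean on $I$ for every $t\in T$ and $m(\pmb{x},\cdot)$ is measurable for every $\pmb{x}\in I^d$. For continuous strictly monotone $f:I\to\mathbb{R}$ and a probability measure $\mu$ on $(T,\mathscr{A})$, the generalized quasi-arithmetic mean is $M_{f,1,m;\mu}(\pmb{x}):=f^{-1}\left(\int_T f(m(\pmb{x},t))\,d\mu(t)\right)$, $\pmb{x}\in I^d$. Regularity class (relative to $\mu_0$). For $q\ge1$, a function $\varphi:I^d\times T\to\mathbb{R}$ is of $L^q$-type at $\pmb{p}\in I^d$ if $\varphi(\pmb{p},\cdot)$ is measurable and there exist $\delta>0$ and $a\in L^q(T,\mathscr{A},\mu_0)$ with $|\varphi(\pmb{x},t)|\le a(t)$ for all $t\in T$ and all $\pmb{x}\in I^d$ with $|\pmb{x}-\pmb{p}|\le\delta$. $\mathscr{C}_2(I^d\times T)$ is the class of measurable families of means $m$ such that for every $t\in T$ the function $m(\cdot,t)$ is twice continuously partially differentiable on $I^d$ and, for all $\pmb{p}\in I^d$ and all $i,j\in\{1,\dots,d\}$, $\partial_i m$ is of $L^1$-type and of $L^2$-type at $\pmb{p}$ and $\partial_i\partial_j m$ is of $L^1$-type at $\pmb{p}$. Here $\partial_i$ acts on the $i$th coordinate of $\pmb{x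}$.
   Formalization: Assertion (v) is read as: h∘f^{-1} is convex (concave) on f(I) provided that h, not f, is increasing (decreasing); as printed it fails for f(x)=x, h(x)=-exp(x), and both readings agree when f and h have the same monotonicity. *)

theory Defs
  imports "HOL-Probability.Probability"
begin

definition cube :: "real set \<Rightarrow> (real ^ 'n) set" where
  "cube I = {x. \<forall>i. x $ i \<in> I}"

definition mean_on :: "real set \<Rightarrow> (real ^ 'n \<Rightarrow> real) \<Rightarrow> bool" where
  "mean_on I M \<longleftrightarrow>
     (\<forall>x\<in>cube I. M x \<in> I \<and> Min (range (($) x)) \<le> M x \<and> M x \<le> Max (range (($) x)))"

definition measurable_family_of_means ::
    "real set \<Rightarrow> 't measure \<Rightarrow> (real ^ 'n \<Rightarrow> 't \<Rightarrow> real) \<Rightarrow> bool" where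
  "measurable_family_of_means I A m \<longleftrightarrow>
     (\<forall>t\<in>space A. mean_on I (\<lambda>x. m x t)) \<and>
     (\<forall>x\<in>cube I. m x \<in> borel_measurable A)"

(* The mean does not change when f is replaced by - f. Hence a comparison of the means of f and h
   corresponds to convexity of h o f^-1 if h is increasing and to concavity if h is decreasing;
   the monotonicity of f is irrelevant. *)
definition quasi_arithmetic_mean ::
    "real set \<Rightarrow> (real \<Rightarrow> real) \<Rightarrow> (real ^ 'n \<Rightarrow> 't \<Rightarrow> real) \<Rightarrow> 't measure \<Rightarrow> real ^ 'n \<Rightarrow> real" where
  "quasi_arithmetic_mean I f m \<mu> x = inv_into I f (\<integral>t. f (m x t) \<partial>\<mu>)"

definition partial :: "'n \<Rightarrow> (real ^ 'n \<Rightarrow> real) \<Rightarrow> real ^ 'n \<Rightarrow> real" where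
  "partial i \<phi> x = deriv (\<lambda>s. \<phi> (x + s *\<^sub>R axis i 1)) 0"

definition partially_differentiable_at :: "'n \<Rightarrow> (real ^ 'n \<Rightarrow> real) \<Rightarrow> real ^ 'n \<Rightarrow> bool" where
  "partially_differentiable_at i \<phi> x \<longleftrightarrow>
     (\<lambda>s. \<phi> (x + s *\<^sub>R axis i 1)) differentiable (at 0)"

(* For open S only: the derivatives at points of S then depend on the values on S alone. *)
definition twice_continuously_partially_differentiable_on ::
    "(real ^ 'n) set \<Rightarrow> (real ^ 'n \<Rightarrow> real) \<Rightarrow> bool" where
  "twice_continuously_partially_differentiable_on S \<phi> \<longleftrightarrow>
     (\<forall>i. (\<forall>x\<in>S. partially_differentiable_at i \<phi> x) \<and> continuous_on S (partial i \<phi>)) \<and>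
     (\<forall>i j. (\<forall>x\<in>S. partially_differentiable_at i (partial j \<phi>) x) \<and>
            continuous_on S (partial i (partial j \<phi>)))"

definition Lq_type ::
    "real \<Rightarrow> real set \<Rightarrow> 't measure \<Rightarrow> (real ^ 'n \<Rightarrow> 't \<Rightarrow> real) \<Rightarrow> real ^ 'n \<Rightarrow> bool" where
  "Lq_type q I \<mu> \<phi> p \<longleftrightarrow>
     \<phi> p \<in> borel_measurable \<mu> \<and>
     (\<exists>\<delta>>0. \<exists>a\<in>borel_measurable \<mu>. integrable \<mu> (\<lambda>t. \<bar>a t\<bar> powr q) \<and>
        (\<forall>t\<in>space \<mu>. \<forall>x\<in>cube I. norm (x - p) \<le> \<delta> \<longrightarrow> \<bar>\<phi> x t\<bar> \<le> a t))"

(* The measurable space is the one underlying \<mu>. *)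
definition mean_class_C2 ::
    "real set \<Rightarrow> 't measure \<Rightarrow> (real ^ 'n \<Rightarrow> 't \<Rightarrow> real) \<Rightarrow> bool" where
  "mean_class_C2 I \<mu> m \<longleftrightarrow>
     measurable_family_of_means I \<mu> m \<and>
     (\<forall>t\<in>space \<mu>. twice_continuously_partially_differentiable_on (cube I) (\<lambda>x. m x t)) \<and>
     (\<forall>p\<in>cube I. \<forall>i j.
        Lq_type 1 I \<mu> (\<lambda>x t. partial i (\<lambda>y. m y t) x) p \<and>
        Lq_type 2 I \<mu> (\<lambda>x t. partial i (\<lambda>y. m y t) x) p \<and>
        Lq_type 1 I \<mu> (\<lambda>x t. partial i (partial j (\<lambda>y. m y t)) x) p)"

definition twice_continuously_differentiable_on :: "real set \<Rightarrow> (real \<Rightarrow> real) \<Rightarrow> bool" where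
  "twice_continuously_differentiable_on I f \<longleftrightarrow>
     f differentiable_on I \<and> deriv f differentiable_on I \<and> continuous_on I (deriv (deriv f))"

definition all_equivalent :: "bool list \<Rightarrow> bool" where
  "all_equivalent Ps \<longleftrightarrow> (\<forall>P\<in>set Ps. \<forall>Q\<in>set Ps. P \<longleftrightarrow> Q)"

end

theory Submission
  imports Defs
begin

text \<open>The two-variable inequality (vi) is the hub. Two applications of the mean value theorem show
  that the difference of its two sides has the sign of \<open>f'' / f' - h'' / h'\<close> at some
  intermediate point, and integrating it at \<open>u = m x t\<close>, \<open>v = M\<^sub>f x\<close> compares the two means.
  If (iv) fails at \<open>x\<^sub>0\<close>, the same integration over a small neighbourhood gives the reversed strict
  comparison at every \<open>x\<close> for which \<open>m x\<close> is not a.e. constant. Such \<open>x\<close> exist arbitrarily close to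
  the diagonal point: otherwise the difference quotients of \<open>m\<close> along a sequence, and hence
  \<open>\<partial>\<^sub>i m\<close> itself, would be a.e. constant. No differentiation under the integral is needed.\<close>

section \<open>Mean value theorem, signs of derivatives and the tangent gap\<close>

text \<open>The mean value theorem without fixing the order of \<open>u\<close> and
  \<open>v\<close>. The condition on \<open>sgn (z - v)\<close> places \<open>z\<close> on the same
  side of \<open>v\<close> as \<open>u\<close>, so that a second application, between
  \<open>z\<close> and \<open>v\<close>, has a controlled sign.\<close>

lemma mvt_between:
  fixes g g' :: "real \<Rightarrow> real"
  assumes J: "is_interval J" "u \<in> J" "v \<in> J" "u \<noteq> v"
    and g: "\<And>x. x \<in> J \<Longrightarrow> (g has_real_derivative g' x) (at x)"
  obtains z where "z \<in> J" "sgn (z - v) = sgn (u - v)" "g u - g v = (u - v) * g' z"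
proof -
  have "min u v \<in> J" "max u v \<in> J"
    using J by (simp_all add: min_def max_def)
  then have sub: "x \<in> J" if "min u v \<le> x" "x \<le> max u v" for x
    using J(1) that unfolding is_interval_1 by blast
  have "min u v < max u v"
    using \<open>u \<noteq> v\<close> by (simp add: min_def max_def)
  from MVT2[OF this g[OF sub]]
  obtain z where z: "z > min u v" "z < max u v"
      "g (max u v) - g (min u v) = (max u v - min u v) * g' z"
    by metis
  have "z \<in> J" using z by (intro sub) linarith+
  moreover have "sgn (z - v) = sgn (u - v)"
    using z by (auto simp: sgn_if min_def max_def split: if_splits)
  moreover have "g u - g v = (u - v) * g' z"
    using z by (cases "u \<le> v") (simp_all add: algebra_simps min_def max_def)
  ultimately show ?thesis using that by blast
qed

lemma twice_continuously_differentiable_onD: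
  assumes "open I" "twice_continuously_differentiable_on I f"
  shows "\<And>x. x \<in> I \<Longrightarrow> (f has_real_derivative deriv f x) (at x)"
    and "\<And>x. x \<in> I \<Longrightarrow> (deriv f has_real_derivative deriv (deriv f) x) (at x)"
    and "continuous_on I f" "continuous_on I (deriv f)" "continuous_on I (deriv (deriv f))"
proof -
  have d: "f differentiable_on I" "deriv f differentiable_on I"
    and c: "continuous_on I (deriv (deriv f))"
    using assms(2) by (auto simp: twice_continuously_differentiable_on_def)
  show "(f has_real_derivative deriv f x) (at x)" if "x \<in> I" for x
    using d(1) that assms(1)
    by (metis DERIV_deriv_iff_real_differentiable at_within_open differentiable_on_def)
  show "(deriv f has_real_derivative deriv (deriv f) x) (at x)" if "x \<in> I" for x
    using d(2) that assms(1)
    by (metis DERIV_deriv_iff_real_differentiable at_within_open differentiable_on_def)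
  show "continuous_on I f" "continuous_on I (deriv f)" "continuous_on I (deriv (deriv f))"
    using d c by (auto intro: differentiable_imp_continuous_on)
qed

text \<open>By the intermediate value theorem a sign change would force a zero. The quotient form
  treats positive and negative functions alike.\<close>

lemma nonvanishing_same_sign:
  fixes g :: "real \<Rightarrow> real"
  assumes "is_interval I" "continuous_on I g" "\<forall>x\<in>I. g x \<noteq> 0" "x \<in> I" "y \<in> I"
  shows "g x / g y > 0"
proof (rule ccontr)
  assume "\<not> g x / g y > 0"
  then have s: "g x < 0 \<and> g y > 0 \<or> g x > 0 \<and> g y < 0"
    using assms(3-5) by (auto simp: zero_less_divide_iff not_less neq_iff)
  have "is_interval (g ` I)"
    using assms(1,2) by (metis connected_continuous_image is_interval_connected_1)
  then have "0 \<in> g ` I" using s assms(4,5) unfolding is_interval_1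
    by (meson imageI less_imp_le)
  then show False using assms(3) by auto
qed

text \<open>The mean value theorem writes the quotient as \<open>u - v\<close> times
  \<open>deriv f z / deriv f v\<close>, and that ratio is positive. Dividing by
  \<open>deriv f v\<close> removes the distinction between increasing and decreasing
  \<open>f\<close>.\<close>

lemma sgn_diff_div_deriv:
  assumes I: "open I" "is_interval I" and f: "twice_continuously_differentiable_on I f"
    and nz: "\<forall>x\<in>I. deriv f x \<noteq> 0" and uv: "u \<in> I" "v \<in> I"
  shows "sgn ((f u - f v) / deriv f v) = sgn (u - v)"
proof (cases "u = v")
  case False
  note f' = twice_continuously_differentiable_onD[OF I(1) f]
  obtain z where z: "z \<in> I" "f u - f v = (u - v) * deriv f z"
    using mvt_between[OF I(2) uv False f'(1)] by metis
  have "deriv f z / deriv f v > 0"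
    by (rule nonvanishing_same_sign[OF I(2) f'(4) nz z(1) uv(2)])
  moreover have "(f u - f v) / deriv f v = (u - v) * (deriv f z / deriv f v)"
    by (simp only: z(2) times_divide_eq_right)
  ultimately show ?thesis by (metis sgn_mult sgn_pos mult_1_right)
qed simp

lemma inj_on_nonvanishing_deriv:
  assumes "open I" "is_interval I" "twice_continuously_differentiable_on I f"
    and "\<forall>x\<in>I. deriv f x \<noteq> 0"
  shows "inj_on f I"
proof (rule inj_onI)
  fix u v assume "u \<in> I" "v \<in> I" "f u = f v"
  then show "u = v" using sgn_diff_div_deriv[OF assms, of u v] by (simp add: sgn_0_0)
qed

text \<open>The derivatives are normalised to \<open>P\<close> and \<open>Q\<close>, both positive
  on \<open>J\<close> and equal to 1 at \<open>v\<close>. The mean value theorem reduces the gap to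
  \<open>P z - Q z\<close>, and a second application, to \<open>ln P - ln Q\<close>, reduces this to
  the point \<open>w\<close>. The interval \<open>J\<close> localises \<open>w\<close>, as needed
  for arguments near a single point of \<open>I\<close>.\<close>

lemma sgn_tangent_gap:
  assumes I: "open I" "is_interval I" and J: "is_interval J" "J \<subseteq> I"
    and f: "twice_continuously_differentiable_on I f" "\<forall>x\<in>I. deriv f x \<noteq> 0"
    and h: "twice_continuously_differentiable_on I h" "\<forall>x\<in>I. deriv h x \<noteq> 0"
    and uv: "u \<in> J" "v \<in> J" "u \<noteq> v"
  obtains w where "w \<in> J"
    "sgn ((f u - f v) / deriv f v - (h u - h v) / deriv h v) =
       sgn (deriv (deriv f) w / deriv f w - deriv (deriv h) w / deriv h w)"
proof -
  note f' = twice_continuously_differentiable_onD[OF I(1) f(1)]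
  note h' = twice_continuously_differentiable_onD[OF I(1) h(1)]
  have vI: "v \<in> I" using uv J by auto
  define P where "P = (\<lambda>x. deriv f x / deriv f v)"
  define Q where "Q = (\<lambda>x. deriv h x / deriv h v)"
  have pos: "P x > 0" "Q x > 0" if "x \<in> J" for x
    unfolding P_def Q_def using that J vI
      nonvanishing_same_sign[OF I(2) f'(4) f(2)] nonvanishing_same_sign[OF I(2) h'(4) h(2)] by auto
  have "((\<lambda>x. f x / deriv f v - h x / deriv h v) has_real_derivative P x - Q x) (at x)"
    if "x \<in> J" for x
    unfolding P_def Q_def using that J
    by (auto intro!: derivative_intros DERIV_cdivide f'(1) h'(1))
  from mvt_between[OF J(1) uv this]
  obtain z where z: "z \<in> J" "sgn (z - v) = sgn (u - v)"
      "f u / deriv f v - h u / deriv h v - (f v / deriv f v - h v / deriv h v) =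
        (u - v) * (P z - Q z)"
    by blast
  then have "z \<noteq> v" using uv by (auto simp: sgn_if split: if_splits)
  \<comment> \<open>Logarithmic derivatives do not see the normalising constants
    \<open>deriv f v\<close> and \<open>deriv h v\<close>.\<close>
  have "((\<lambda>x. ln (P x) - ln (Q x)) has_real_derivative
      deriv (deriv f) x / deriv f x - deriv (deriv h) x / deriv h x) (at x)" if "x \<in> J" for x
  proof -
    have xI: "x \<in> I" using that J by auto
    have 1: "(P has_real_derivative deriv (deriv f) x / deriv f v) (at x)"
            "(Q has_real_derivative deriv (deriv h) x / deriv h v) (at x)"
      unfolding P_def Q_def using xI by (auto intro!: DERIV_cdivide f'(2) h'(2))
    have "((\<lambda>x. ln (P x) - ln (Q x)) has_real_derivative
      1 / P x * (deriv (deriv f) x / deriv f v) - 1 / Q x * (deriv (deriv h) x / deriv h v)) (at x)"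
      using pos[OF that] 1 by (auto intro!: derivative_eq_intros)
    then show ?thesis unfolding P_def Q_def using f(2) h(2) xI vI by simp
  qed
  from mvt_between[OF J(1) z(1) uv(2) \<open>z \<noteq> v\<close> this]
  obtain w where w: "w \<in> J" "ln (P z) - ln (Q z) - (ln (P v) - ln (Q v)) =
      (z - v) * (deriv (deriv f) w / deriv f w - deriv (deriv h) w / deriv h w)"
    by blast
  have "P v = 1" "Q v = 1" unfolding P_def Q_def using f h vI by auto
  then have l: "ln (P z) - ln (Q z) =
      (z - v) * (deriv (deriv f) w / deriv f w - deriv (deriv h) w / deriv h w)"
    using w(2) by simp
  have "(f u - f v) / deriv f v - (h u - h v) / deriv h v = (u - v) * (P z - Q z)"
    unfolding z(3)[symmetric] diff_divide_distrib by linarith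
  then have "sgn ((f u - f v) / deriv f v - (h u - h v) / deriv h v) = sgn ((u - v) * (P z - Q z))"
    by (rule arg_cong)
  \<comment> \<open>\<open>ln\<close> is strictly increasing on the positive reals, so passing to
    logarithms keeps the sign.\<close>
  also have "\<dots> = sgn (u - v) * sgn (ln (P z) - ln (Q z))"
    using pos[OF z(1)] by (simp add: sgn_mult) (auto simp: sgn_if)
  also have "\<dots> = sgn (u - v) * sgn (z - v) *
      sgn (deriv (deriv f) w / deriv f w - deriv (deriv h) w / deriv h w)"
    by (simp only: l sgn_mult mult.assoc)
  \<comment> \<open>\<open>z\<close> lies on the same side of \<open>v\<close> as \<open>u\<close>;
    hence the final sign does not depend on whether \<open>u\<close> is above or below
    \<open>v\<close>.\<close>
  also have "sgn (u - v) * sgn (z - v) = 1"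
    using z(2) uv(3) by (auto simp: sgn_if)
  finally show ?thesis using w(1) that by simp
qed

section \<open>Convexity of \<open>h \<circ> inv_into I f\<close> and the tangent inequality\<close>

text \<open>The hypothesis gives a supporting line of slope \<open>k v\<close> at every point
  \<open>f v\<close>. With \<open>f v\<close> chosen as the convex combination of \<open>f a\<close>
  and \<open>f b\<close>, averaging the inequalities at \<open>a\<close> and \<open>b\<close>
  cancels the slope terms.\<close>

lemma convex_on_comp_inv_intoI:
  fixes f h :: "real \<Rightarrow> real"
  assumes I: "is_interval I" "continuous_on I f" "inj_on f I"
    and k: "\<And>u v. u \<in> I \<Longrightarrow> v \<in> I \<Longrightarrow> h v + k v * (f u - f v) \<le> h u"
  shows "convex_on (f ` I) (h \<circ> inv_into I f)"
proof (rule convex_onI)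
  show conv: "convex (f ` I)"
    using I by (metis connected_continuous_image is_interval_connected_1 is_interval_convex)
  fix t x y :: real
  assume t: "0 < t" "t < 1" and xy: "x \<in> f ` I" "y \<in> f ` I"
  then obtain a b where ab: "a \<in> I" "b \<in> I" "x = f a" "y = f b" by auto
  have "(1 - t) * x + t * y \<in> f ` I"
    using convexD[OF conv xy, of "1 - t" t] t by simp
  then obtain v where v: "v \<in> I" "(1 - t) * x + t * y = f v" by auto
  have 1: "(1 - t) * (h v + k v * (f a - f v)) \<le> (1 - t) * h a"
    using k[OF ab(1) v(1)] t by (intro mult_left_mono) auto
  have 2: "t * (h v + k v * (f b - f v)) \<le> t * h b"
    using k[OF ab(2) v(1)] t by (intro mult_left_mono) auto
  have "(1 - t) * (h v + k v * (f a - f v)) + t * (h v + k v * (f b - f v)) =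
      h v + k v * ((1 - t) * f a + t * f b - f v)" by (simp add: algebra_simps)
  then have "h v \<le> (1 - t) * h a + t * h b" using 1 2 v(2) ab by simp
  then show "(h \<circ> inv_into I f) ((1 - t) *\<^sub>R x + t *\<^sub>R y)
      \<le> (1 - t) * (h \<circ> inv_into I f) x + t * (h \<circ> inv_into I f) y"
    using v ab I(3) by simp
qed

text \<open>A convex function lies above its tangents, and \<open>E / D\<close> is the slope of
  \<open>h \<circ> inv_into I f\<close> at \<open>f v\<close> by the inverse function and chain
  rules.\<close>

lemma convex_on_comp_inv_intoD:
  fixes f h :: "real \<Rightarrow> real"
  assumes I: "open I" "is_interval I" "continuous_on I f" "inj_on f I"
    and cv: "convex_on (f ` I) (h \<circ> inv_into I f)"
    and d: "(f has_real_derivative D) (at v)" "D \<noteq> 0" "(h has_real_derivative E) (at v)"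
    and uv: "u \<in> I" "v \<in> I"
  shows "h v + E / D * (f u - f v) \<le> h u"
proof -
  have inv: "inv_into I f (f x) = x" if "x \<in> I" for x
    using that I(4) by (rule inv_into_f_f[rotated])
  have D: "(*) D \<circ> (*) (inverse D) = id"
    using d(2) by (simp add: fun_eq_iff)
  have "(inv_into I f has_real_derivative inverse D) (at (f v))"
    unfolding has_field_derivative_def
    by (rule has_derivative_inverse_strong
        [OF I(1) uv(2) I(3) inv d(1)[unfolded has_field_derivative_def] D])
  moreover have "(h has_real_derivative E) (at (inv_into I f (f v)))"
    unfolding inv[OF uv(2)] by (rule d(3))
  ultimately have "((h \<circ> inv_into I f) has_real_derivative E * inverse D) (at (f v))"
    by (rule DERIV_chain[rotated])
  then have "((h \<circ> inv_into I f) has_real_derivative E * inverse D) (at (f v) within f ` I)"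
    by (rule has_field_derivative_at_within)
  \<comment> \<open>Invariance of domain makes \<open>f v\<close> an interior point, as the tangent
    inequality requires.\<close>
  moreover have "open (f ` I)"
    by (rule invariance_of_domain[OF I(3,1,4)])
  then have "f v \<in> interior (f ` I)"
    using uv(2) by (simp add: interior_open)
  moreover have "connected (f ` I)"
    by (rule connected_continuous_image[OF I(3)]) (use I(2) is_interval_connected_1 in blast)
  ultimately have "(h \<circ> inv_into I f) (f u) - (h \<circ> inv_into I f) (f v) \<ge> E * inverse D * (f u - f v)"
    using uv(1) by (intro convex_on_imp_above_tangent[OF cv]) blast+
  then show ?thesis by (simp add: inv uv divide_inverse)
qed

text \<open>The sign of the derivative is constant on the interval and decides the monotonicity. The
  negated clauses ensure that exactly one of two implications guarded by the monotonicity of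
  \<open>h\<close> has content.\<close>

lemma deriv_same_sign_cases:
  assumes I: "open I" "is_interval I" "I \<noteq> {}" and h: "twice_continuously_differentiable_on I h"
    and nz: "\<forall>x\<in>I. deriv h x \<noteq> 0"
  shows "(\<forall>x\<in>I. deriv h x > 0) \<and> strict_mono_on I h \<and> \<not> strict_antimono_on I h \<or>
         (\<forall>x\<in>I. deriv h x < 0) \<and> \<not> strict_mono_on I h \<and> strict_antimono_on I h"
proof -
  obtain x0 where x0: "x0 \<in> I" using I by auto
  \<comment> \<open>A second point of \<open>I\<close> is required: on a single point
    \<open>h\<close> would be both strictly increasing and strictly decreasing.\<close>
  obtain \<epsilon> where "\<epsilon> > 0" "cball x0 \<epsilon> \<subseteq> I" using I(1) x0 open_contains_cball by blast
  then have "x0 + \<epsilon> \<in> I" by (auto simp: dist_norm)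
  then obtain x1 where x1: "x1 \<in> I" "x0 < x1" using \<open>\<epsilon> > 0\<close> by (metis less_add_same_cancel1)
  have ss: "deriv h x / deriv h y > 0" if "x \<in> I" "y \<in> I" for x y
    using nonvanishing_same_sign[OF I(2) _ nz that] twice_continuously_differentiable_onD(4)[OF I(1) h]
    by auto
  have sg: "(h y - h x) / deriv h x > 0" if "x \<in> I" "y \<in> I" "x < y" for x y
    using sgn_diff_div_deriv[OF I(1,2) h nz that(2,1)] that
    by (metis diff_gt_0_iff_gt sgn_1_pos sgn_pos)
  show ?thesis
  proof (cases "deriv h x0 > 0")
    case True
    then have p: "\<forall>x\<in>I. deriv h x > 0" using ss x0 by (fastforce simp: zero_less_divide_iff)
    then have sm: "h x < h y" if "x \<in> I" "y \<in> I" "x < y" for x y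
      using sg[OF that] that by (fastforce simp: zero_less_divide_iff)
    then have "strict_mono_on I h" by (auto intro: strict_mono_onI)
    moreover have "\<not> strict_antimono_on I h"
      using sm[OF x0 x1] x0 x1 unfolding monotone_on_def by (meson less_asym)
    ultimately show ?thesis using p by auto
  next
    case False
    then have p: "\<forall>x\<in>I. deriv h x < 0" using ss x0 by (fastforce simp: zero_less_divide_iff)
    then have sm: "h x > h y" if "x \<in> I" "y \<in> I" "x < y" for x y
      using sg[OF that] that by (fastforce simp: zero_less_divide_iff)
    then have "strict_antimono_on I h" by (auto simp: monotone_on_def)
    moreover have "\<not> strict_mono_on I h"
      using sm[OF x0 x1] x0 x1 unfolding monotone_on_def by (meson less_asym)
    ultimately show ?thesis using p by auto
  qed
qed

text \<open>Multiplication by \<open>deriv h v\<close> turns the inequality into the supporting line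
  of \<open>h \<circ> inv_into I f\<close> at \<open>f v\<close>, with slope
  \<open>deriv h v / deriv f v\<close>. A negative \<open>deriv h v\<close> reverses the inequality,
  which gives concavity.\<close>

lemma tangent_inequality_iff_convex_concave:
  assumes I: "open I" "is_interval I" "I \<noteq> {}"
    and f: "twice_continuously_differentiable_on I f" "\<forall>x\<in>I. deriv f x \<noteq> 0"
    and h: "twice_continuously_differentiable_on I h" "\<forall>x\<in>I. deriv h x \<noteq> 0"
  shows "(\<forall>u\<in>I. \<forall>v\<in>I. (f u - f v) / deriv f v \<le> (h u - h v) / deriv h v) \<longleftrightarrow>
    (strict_mono_on I h \<longrightarrow> convex_on (f ` I) (h \<circ> inv_into I f)) \<and>
    (strict_antimono_on I h \<longrightarrow> concave_on (f ` I) (h \<circ> inv_into I f))"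
proof -
  note f' = twice_continuously_differentiable_onD[OF I(1) f(1)]
  note h' = twice_continuously_differentiable_onD[OF I(1) h(1)]
  have inj: "inj_on f I" by (rule inj_on_nonvanishing_deriv[OF I(1,2) f])
  \<comment> \<open>Stated for a general \<open>g\<close> so that it serves for \<open>h\<close>
    and, in the concave case, for the negative of \<open>h\<close>.\<close>
  have iff: "convex_on (f ` I) (g \<circ> inv_into I f) \<longleftrightarrow>
      (\<forall>u\<in>I. \<forall>v\<in>I. g v + g' v / deriv f v * (f u - f v) \<le> g u)"
    if "\<And>x. x \<in> I \<Longrightarrow> (g has_real_derivative g' x) (at x)" for g g'
    using convex_on_comp_inv_intoD[OF I(1,2) f'(3) inj _ f'(1) _ that] f(2)
      convex_on_comp_inv_intoI[OF I(2) f'(3) inj, where h = g and k = "\<lambda>v. g' v / deriv f v"]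
    by blast
  have neg: "concave_on (f ` I) (h \<circ> inv_into I f) \<longleftrightarrow>
      convex_on (f ` I) ((\<lambda>x. - h x) \<circ> inv_into I f)"
    by (simp add: concave_on_def o_def)
  have dneg: "\<And>x. x \<in> I \<Longrightarrow> ((\<lambda>x. - h x) has_real_derivative - deriv h x) (at x)"
    by (intro DERIV_minus h'(1))
  from deriv_same_sign_cases[OF I h] show ?thesis
  proof (elim disjE conjE)
    assume p: "\<forall>x\<in>I. deriv h x > 0" "strict_mono_on I h" "\<not> strict_antimono_on I h"
    have "(f u - f v) / deriv f v \<le> (h u - h v) / deriv h v \<longleftrightarrow>
        h v + deriv h v / deriv f v * (f u - f v) \<le> h u" if "v \<in> I" for u v
    proof -
      have "(f u - f v) / deriv f v \<le> (h u - h v) / deriv h v \<longleftrightarrow>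
        (f u - f v) / deriv f v * deriv h v \<le> h u - h v" using p(1) that by (simp add: pos_le_divide_eq)
      then show ?thesis by (simp add: algebra_simps)
    qed
    then show ?thesis using p(2,3) iff[OF h'(1)] by simp
  next
    assume p: "\<forall>x\<in>I. deriv h x < 0" "\<not> strict_mono_on I h" "strict_antimono_on I h"
    have "(f u - f v) / deriv f v \<le> (h u - h v) / deriv h v \<longleftrightarrow>
        - h v + - deriv h v / deriv f v * (f u - f v) \<le> - h u" if "v \<in> I" for u v
    proof -
      have "(f u - f v) / deriv f v \<le> (h u - h v) / deriv h v \<longleftrightarrow>
        (f u - f v) / deriv f v * deriv h v \<ge> h u - h v" using p(1) that by (simp add: neg_le_divide_eq)
      then show ?thesis by (simp add: algebra_simps)
    qed
    then show ?thesis using p(2,3) iff[OF dneg] neg by simp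
  qed
qed

section \<open>Quasi-arithmetic means: well-definedness and comparison by integration\<close>

lemma quasi_arithmetic_mean_props:
  fixes m :: "real ^ 'n::finite \<Rightarrow> 't \<Rightarrow> real"
  assumes M: "prob_space M" "measurable_family_of_means I M m" and x: "x \<in> cube J"
    and J: "is_interval J" "J \<subseteq> I"
    and f: "continuous_on I f" "inj_on f I"
  shows "integrable M (\<lambda>t. f (m x t))"
    and "\<And>t. t \<in> space M \<Longrightarrow> m x t \<in> J"
    and "quasi_arithmetic_mean I f m M x \<in> J"
    and "f (quasi_arithmetic_mean I f m M x) = (\<integral>t. f (m x t) \<partial>M)"
proof -
  interpret prob_space M by (rule M(1))
  define a b where "a = Min (range (($) x))" and "b = Max (range (($) x))"
  have xI: "x \<in> cube I" using x J by (auto simp: cube_def)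
  have mean: "a \<le> m x t" "m x t \<le> b" if "t \<in> space M" for t
    using M(2) xI that unfolding measurable_family_of_means_def mean_on_def a_def b_def by auto
  have "a \<in> range (($) x)" "b \<in> range (($) x)"
    unfolding a_def b_def by (auto intro!: Min_in Max_in)
  then have "a \<in> J" "b \<in> J" using x by (auto simp: cube_def)
  then have abJ: "{a..b} \<subseteq> J"
    using J(1) unfolding is_interval_1 by (meson atLeastAtMost_iff subsetI)
  then have abI: "{a..b} \<subseteq> I" using J by auto
  show "m x t \<in> J" if "t \<in> space M" for t using mean[OF that] abJ by auto
  have "a \<le> b" using mean not_empty by fastforce
  then obtain c d where cd: "f ` {a..b} = {c..d}" "c \<le> d"
    using continuous_image_closed_interval[of a b f] continuous_on_subset[OF f(1) abI] by auto
  have bd: "f (m x t) \<in> {c..d}" if "t \<in> space M" for t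
    using mean[OF that] cd by auto
  have "m x \<in> borel_measurable M"
    using M(2) xI unfolding measurable_family_of_means_def by auto
  \<comment> \<open>Nothing is known about \<open>f\<close> outside \<open>I\<close>, so
    \<open>m x\<close> is viewed as a map into \<open>I\<close>, where continuity makes
    \<open>f\<close> measurable.\<close>
  then have "m x \<in> measurable M (restrict_space borel I)"
    using mean abI by (intro measurable_restrict_space2) auto
  then have meas: "(\<lambda>t. f (m x t)) \<in> borel_measurable M"
    by (rule measurable_compose) (rule borel_measurable_continuous_on_restrict[OF f(1)])
  show int: "integrable M (\<lambda>t. f (m x t))"
    using bd by (intro integrable_const_bound[OF _ meas, of "\<bar>c\<bar> + \<bar>d\<bar>"] AE_I2) fastforce
  have "(\<integral>t. f (m x t) \<partial>M) \<in> {c..d}"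
    using integral_ge_const[OF int, of c] integral_le_const[OF int, of d] bd by auto
  then obtain w where w: "w \<in> {a..b}" "(\<integral>t. f (m x t) \<partial>M) = f w"
    unfolding cd(1)[symmetric] by (rule imageE)
  have "quasi_arithmetic_mean I f m M x = w"
    unfolding quasi_arithmetic_mean_def w(2) using w(1) abI f(2) by auto
  then show "quasi_arithmetic_mean I f m M x \<in> J"
    "f (quasi_arithmetic_mean I f m M x) = (\<integral>t. f (m x t) \<partial>M)" using w abJ by auto
qed

text \<open>By the choice of \<open>v\<close> the \<open>f\<close> term integrates to zero, and the
  \<open>h\<close> term integrates to the normalised difference of \<open>h\<close> between the
  \<open>h\<close>-mean and \<open>v\<close>, which has the sign of the difference of the
  means.\<close>

lemma sgn_quasi_arithmetic_mean_diff:
  fixes m :: "real ^ 'n::finite \<Rightarrow> 't \<Rightarrow> real"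
  assumes I: "open I" "is_interval I"
    and f: "twice_continuously_differentiable_on I f" "\<forall>x\<in>I. deriv f x \<noteq> 0"
    and h: "twice_continuously_differentiable_on I h" "\<forall>x\<in>I. deriv h x \<noteq> 0"
    and M: "prob_space M" "measurable_family_of_means I M m" and x: "x \<in> cube I"
  defines "v \<equiv> quasi_arithmetic_mean I f m M x"
  shows "integrable M (\<lambda>t. (h (m x t) - h v) / deriv h v - (f (m x t) - f v) / deriv f v)"
    and "sgn (quasi_arithmetic_mean I h m M x - v) =
      sgn (\<integral>t. ((h (m x t) - h v) / deriv h v - (f (m x t) - f v) / deriv f v) \<partial>M)"
proof -
  interpret prob_space M by (rule M(1))
  note pf = quasi_arithmetic_mean_props[OF M x I(2) subset_refl
      twice_continuously_differentiable_onD(3)[OF I(1) f(1)] inj_on_nonvanishing_deriv[OF I f]]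
  note ph = quasi_arithmetic_mean_props[OF M x I(2) subset_refl
      twice_continuously_differentiable_onD(3)[OF I(1) h(1)] inj_on_nonvanishing_deriv[OF I h]]
  note [simp] = pf(1) ph(1)
  show "integrable M (\<lambda>t. (h (m x t) - h v) / deriv h v - (f (m x t) - f v) / deriv f v)"
    by simp
  have "(\<integral>t. ((h (m x t) - h v) / deriv h v - (f (m x t) - f v) / deriv f v) \<partial>M) =
      (h (quasi_arithmetic_mean I h m M x) - h v) / deriv h v"
    using pf(4) ph(4) by (simp add: prob_space v_def)
  then show "sgn (quasi_arithmetic_mean I h m M x - v) =
      sgn (\<integral>t. ((h (m x t) - h v) / deriv h v - (f (m x t) - f v) / deriv f v) \<partial>M)"
    using sgn_diff_div_deriv[OF I h ph(3), of v] pf(3) by (simp add: v_def)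
qed

section \<open>Necessity of the derivative condition near the diagonal\<close>

text \<open>If \<open>m\<close> were a.e. constant at all small displacements along the
  \<open>i\<close>-th axis, its difference quotients along a null sequence would a.e. be numbers
  independent of \<open>t\<close>, and so would their limit, the partial derivative.\<close>

lemma nonconstant_near_diagonal:
  fixes m :: "real ^ 'n::finite \<Rightarrow> 't \<Rightarrow> real"
  assumes mean: "\<And>t. t \<in> space M \<Longrightarrow> mean_on I (\<lambda>x. m x t)"
    and diff: "\<And>t. t \<in> space M \<Longrightarrow> partially_differentiable_at i (\<lambda>x. m x t) (vec x0)"
    and nc: "\<not> (\<exists>c. AE t in M. partial i (\<lambda>x. m x t) (vec x0) = c)"
    and "x0 \<in> I" "\<epsilon> > 0"
  obtains s where "0 < s" "s < \<epsilon>" "\<not> (\<exists>c. AE t in M. m (vec x0 + s *\<^sub>R axis i 1) t = c)"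
proof (rule ccontr)
  assume "\<not> thesis"
  then have "\<exists>c. AE t in M. m (vec x0 + s *\<^sub>R axis i 1) t = c" if "0 < s" "s < \<epsilon>" for s
    using that \<open>\<And>s. \<lbrakk>0 < s; s < \<epsilon>; _\<rbrakk> \<Longrightarrow> thesis\<close> by blast
  then obtain c where c: "\<And>s. 0 < s \<Longrightarrow> s < \<epsilon> \<Longrightarrow> AE t in M. m (vec x0 + s *\<^sub>R axis i 1) t = c s"
    by metis
  \<comment> \<open>The shift by 2 gives \<open>s n < \<epsilon>\<close> already at
    \<open>n = 0\<close>. A sequence is used so that only countably many null sets have to be
    merged.\<close>
  define s where "s n = \<epsilon> / real (n + 2)" for n
  have s: "0 < s n" "s n < \<epsilon>" for n using \<open>\<epsilon> > 0\<close> by (auto simp: s_def field_simps intro!: add_pos_nonneg)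
  have "s \<longlonglongrightarrow> 0" unfolding s_def by real_asymp
  then have s_at: "filterlim s (at 0) sequentially"
    using s by (auto simp: filterlim_at intro!: always_eventually) (metis less_irrefl)
  have "AE t in M. \<forall>n. m (vec x0 + s n *\<^sub>R axis i 1) t = c (s n)"
    using c s by (simp add: AE_all_countable)
  then have "AE t in M. partial i (\<lambda>x. m x t) (vec x0) = lim (\<lambda>n. (c (s n) - x0) / s n)"
  proof (rule AE_mp, intro AE_I2 impI)
    fix t assume t: "t \<in> space M" and eq: "\<forall>n. m (vec x0 + s n *\<^sub>R axis i 1) t = c (s n)"
    have "vec x0 \<in> cube I" using \<open>x0 \<in> I\<close> by (simp add: cube_def)
    \<comment> \<open>On the diagonal the least and greatest coordinates coincide.\<close>
    then have "m (vec x0) t = x0"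
      using mean[OF t] by (force simp: mean_on_def image_constant_conv)
    moreover have "((\<lambda>s. m (vec x0 + s *\<^sub>R axis i 1) t) has_real_derivative
        partial i (\<lambda>x. m x t) (vec x0)) (at 0)"
      using diff[OF t] unfolding partially_differentiable_at_def partial_def
      by (simp add: DERIV_deriv_iff_real_differentiable)
    ultimately have "((\<lambda>s. (m (vec x0 + s *\<^sub>R axis i 1) t - x0) / s) \<longlongrightarrow>
        partial i (\<lambda>x. m x t) (vec x0)) (at 0)"
      by (simp add: DERIV_def)
    from filterlim_compose[OF this s_at]
    have "(\<lambda>n. (c (s n) - x0) / s n) \<longlonglongrightarrow> partial i (\<lambda>x. m x t) (vec x0)"
      using eq by simp
    then show "partial i (\<lambda>x. m x t) (vec x0) = lim (\<lambda>n. (c (s n) - x0) / s n)"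
      by (rule limI[symmetric])
  qed
  then show False using nc by blast
qed

text \<open>If the inequality fails at \<open>x0\<close>, it fails strictly on a ball
  \<open>V\<close>, where the gap \<open>G\<close> is then negative except at \<open>v\<close>. The
  comparison of the means makes the integral of \<open>G (m x t)\<close> nonnegative, so
  \<open>m x t = v\<close> a.e., against the choice of \<open>x\<close>.\<close>

lemma local_comparison_imp_deriv_ratio_le:
  fixes m :: "real ^ 'n::finite \<Rightarrow> 't \<Rightarrow> real"
  assumes I: "open I" "is_interval I"
    and f: "twice_continuously_differentiable_on I f" "\<forall>x\<in>I. deriv f x \<noteq> 0"
    and h: "twice_continuously_differentiable_on I h" "\<forall>x\<in>I. deriv h x \<noteq> 0"
    and M: "prob_space M" "measurable_family_of_means I M m" and x0: "x0 \<in> I"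
    and diff: "\<And>t. t \<in> space M \<Longrightarrow> partially_differentiable_at i (\<lambda>x. m x t) (vec x0)"
    and nc: "\<not> (\<exists>c. AE t in M. partial i (\<lambda>x. m x t) (vec x0) = c)"
    and U: "U \<subseteq> I" "x0 \<in> interior U"
    and le: "\<And>x. x \<in> cube U \<Longrightarrow> quasi_arithmetic_mean I f m M x \<le> quasi_arithmetic_mean I h m M x"
  shows "deriv (deriv f) x0 / deriv f x0 \<le> deriv (deriv h) x0 / deriv h x0"
proof (rule ccontr)
  assume gt: "\<not> ?thesis"
  interpret prob_space M by (rule M(1))
  note f' = twice_continuously_differentiable_onD[OF I(1) f(1)]
  note h' = twice_continuously_differentiable_onD[OF I(1) h(1)]
  \<comment> \<open>\<open>F\<close> is continuous because the second derivatives are, so its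
    positivity at \<open>x0\<close> extends to a neighbourhood.\<close>
  define F where "F x = deriv (deriv f) x / deriv f x - deriv (deriv h) x / deriv h x" for x
  have F: "continuous_on I F"
    unfolding F_def using f h by (intro continuous_intros f' h') auto
  have "open (I \<inter> F -` {0<..})"
    by (rule continuous_open_preimage[OF F I(1) open_greaterThan])
  then have "open ((I \<inter> F -` {0<..}) \<inter> interior U)" by (rule open_Int[OF _ open_interior])
  moreover have "x0 \<in> (I \<inter> F -` {0<..}) \<inter> interior U"
    using gt x0 U by (simp add: F_def)
  ultimately obtain \<epsilon> where \<epsilon>: "\<epsilon> > 0" "ball x0 \<epsilon> \<subseteq> (I \<inter> F -` {0<..}) \<inter> interior U"
    by (metis open_contains_ball)
  define V where "V = ball x0 \<epsilon>"
  have V: "is_interval V" "V \<subseteq> I" "V \<subseteq> U" "\<And>w. w \<in> V \<Longrightarrow> F w > 0"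
    using \<epsilon> interior_subset[of U] unfolding V_def by (auto simp: is_interval_ball_real)
  obtain s where s: "0 < s" "s < \<epsilon>" and ncs: "\<not> (\<exists>c. AE t in M. m (vec x0 + s *\<^sub>R axis i 1) t = c)"
    using nonconstant_near_diagonal[OF _ diff nc x0 \<epsilon>(1)] M(2)
    unfolding measurable_family_of_means_def by metis
  \<comment> \<open>A diagonal point moved in one coordinate by less than the radius of
    \<open>V\<close>: all its coordinates stay in \<open>V\<close>, hence so do the values
    \<open>m x t\<close> and the mean \<open>v\<close>.\<close>
  define x where "x = vec x0 + s *\<^sub>R axis i (1::real)"
  have xV: "x \<in> cube V"
    using s \<epsilon>(1) unfolding cube_def V_def x_def by (auto simp: axis_def dist_real_def)
  then have xI: "x \<in> cube I" and xU: "x \<in> cube U" using V by (auto simp: cube_def)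
  define v where "v = quasi_arithmetic_mean I f m M x"
  note pf = quasi_arithmetic_mean_props[OF M xV V(1,2) f'(3) inj_on_nonvanishing_deriv[OF I f]]
  note d = sgn_quasi_arithmetic_mean_diff[OF I f h M xI, folded v_def]
  define G where "G u = (h u - h v) / deriv h v - (f u - f v) / deriv f v" for u
  have G: "G u < 0" if "u \<in> V" "u \<noteq> v" for u
  proof -
    have "v \<in> V" using pf(3) by (simp add: v_def)
    from sgn_tangent_gap[OF I V(1,2) f h that(1) this that(2)] obtain w
      where "w \<in> V" "sgn ((f u - f v) / deriv f v - (h u - h v) / deriv h v) = sgn (F w)"
      unfolding F_def by blast
    then have "(f u - f v) / deriv f v - (h u - h v) / deriv h v > 0"
      using V(4) by (metis sgn_1_pos sgn_pos)
    then show ?thesis by (simp add: G_def)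
  qed
  have G0: "G v = 0" by (simp add: G_def)
  have Gle: "G (m x t) \<le> 0" if "t \<in> space M" for t
    using G[OF pf(2)[OF that]] G0 by (cases "m x t = v") auto
  have int: "integrable M (\<lambda>t. G (m x t))" using d(1) by (simp add: G_def)
  have "sgn (\<integral>t. G (m x t) \<partial>M) \<ge> 0"
    using d(2) le[OF xU] unfolding G_def v_def by (metis diff_ge_0_iff_ge zero_le_sgn_iff)
  then have ge: "(\<integral>t. G (m x t) \<partial>M) \<ge> 0" by simp
  \<comment> \<open>The integrand is nonnegative and its integral is at most 0, so it vanishes
    a.e.\<close>
  have "(\<integral>t. - G (m x t) \<partial>M) = 0"
    using ge integral_nonneg_AE[where M = M and f = "\<lambda>t. - G (m x t)"] Gle by (auto intro!: antisym)
  then have "AE t in M. - G (m x t) = 0"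
    using integral_nonneg_eq_0_iff_AE[where M = M and f = "\<lambda>t. - G (m x t)"] int Gle by auto
  then have "AE t in M. m x t = v"
  proof (rule AE_mp, intro AE_I2 impI)
    fix t assume "t \<in> space M" "- G (m x t) = 0"
    then show "m x t = v" using G[OF pf(2)] by fastforce
  qed
  then show False using ncs unfolding x_def by blast
qed

section \<open>Equivalence of the six assertions\<close>

theorem theorem15:
  fixes I :: "real set" and f h :: "real \<Rightarrow> real"
    and A \<mu>\<^sub>0 :: "'t measure"
    and d :: nat and e :: "nat \<Rightarrow> 'n::finite"
    and m :: "real ^ 'n \<Rightarrow> 't \<Rightarrow> real"
  assumes "open I" and "is_interval I" and "I \<noteq> {}"
    and "d \<ge> 2" and "bij_betw e {1..d} UNIV"
    and "twice_continuously_differentiable_on I f" and "\<forall>x\<in>I. deriv f x \<noteq> 0"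
    and "twice_continuously_differentiable_on I h" and "\<forall>x\<in>I. deriv h x \<noteq> 0"
    and "prob_space \<mu>\<^sub>0" and "sets \<mu>\<^sub>0 = sets A"
    and "mean_class_C2 I \<mu>\<^sub>0 m"
    and "\<forall>x\<^sub>0\<in>I. \<exists>i\<in>{1..d - 1}.
           \<not> (\<exists>c. AE t in \<mu>\<^sub>0. partial (e i) (\<lambda>x. m x t) (vec x\<^sub>0) = c)"
  shows "all_equivalent
    [\<forall>\<mu>. prob_space \<mu> \<and> sets \<mu> = sets A \<longrightarrow>
       (\<forall>x\<in>cube I. quasi_arithmetic_mean I f m \<mu> x \<le> quasi_arithmetic_mean I h m \<mu> x),
     \<forall>x\<in>cube I. quasi_arithmetic_mean I f m \<mu>\<^sub>0 x \<le> quasi_arithmetic_mean I h m \<mu>\<^sub>0 x,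
     \<forall>x\<^sub>0\<in>I. \<exists>U\<subseteq>I. x\<^sub>0 \<in> interior U \<and>
       (\<forall>x\<in>cube U. quasi_arithmetic_mean I f m \<mu>\<^sub>0 x \<le> quasi_arithmetic_mean I h m \<mu>\<^sub>0 x),
     \<forall>x\<in>I. deriv (deriv f) x / deriv f x \<le> deriv (deriv h) x / deriv h x,
     (strict_mono_on I h \<longrightarrow> convex_on (f ` I) (h \<circ> inv_into I f)) \<and>
       (strict_antimono_on I h \<longrightarrow> concave_on (f ` I) (h \<circ> inv_into I f)),
     \<forall>u\<in>I. \<forall>v\<in>I. (f u - f v) / deriv f v \<le> (h u - h v) / deriv h v]"
proof -
  note I = assms(1,2) and f = assms(6,7) and h = assms(8,9)
  have means: "measurable_family_of_means I \<mu>\<^sub>0 m"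
    and C2: "\<And>t. t \<in> space \<mu>\<^sub>0 \<Longrightarrow>
      twice_continuously_partially_differentiable_on (cube I) (\<lambda>x. m x t)"
    using assms(12) unfolding mean_class_C2_def by auto
  have iv_vi: "(f u - f v) / deriv f v \<le> (h u - h v) / deriv h v"
    if iv: "\<forall>x\<in>I. deriv (deriv f) x / deriv f x \<le> deriv (deriv h) x / deriv h x"
      and uv: "u \<in> I" "v \<in> I" for u v
  proof (cases "u = v")
    case False
    obtain w where w: "w \<in> I" "sgn ((f u - f v) / deriv f v - (h u - h v) / deriv h v) =
       sgn (deriv (deriv f) w / deriv f w - deriv (deriv h) w / deriv h w)"
      using sgn_tangent_gap[OF I I(2) subset_refl f h uv False] by blast
    have "sgn (deriv (deriv f) w / deriv f w - deriv (deriv h) w / deriv h w) \<le> 0"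
      using iv w(1) by simp
    then have "(f u - f v) / deriv f v - (h u - h v) / deriv h v \<le> 0"
      unfolding w(2)[symmetric] by (simp only: sgn_le_0_iff)
    then show ?thesis by simp
  qed simp
  have vi_i: "quasi_arithmetic_mean I f m \<mu> x \<le> quasi_arithmetic_mean I h m \<mu> x"
    if vi: "\<forall>u\<in>I. \<forall>v\<in>I. (f u - f v) / deriv f v \<le> (h u - h v) / deriv h v"
      and \<mu>: "prob_space \<mu>" "sets \<mu> = sets A" and x: "x \<in> cube I" for \<mu> x
  proof -
    have sets: "sets \<mu> = sets \<mu>\<^sub>0" using \<mu>(2) assms(11) by simp
    \<comment> \<open>The notion depends only on the underlying measurable space, which
      \<open>\<mu>\<close> and \<open>\<mu>\<^sub>0\<close> share.\<close>
    have means': "measurable_family_of_means I \<mu> m"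
      using means unfolding measurable_family_of_means_def
      by (simp add: sets_eq_imp_space_eq[OF sets] measurable_cong_sets[OF sets refl])
    note pf = quasi_arithmetic_mean_props[OF \<mu>(1) means' x I(2) subset_refl
        twice_continuously_differentiable_onD(3)[OF I(1) f(1)] inj_on_nonvanishing_deriv[OF I f]]
    let ?v = "quasi_arithmetic_mean I f m \<mu> x"
    \<comment> \<open>The integrand is nonnegative pointwise, by the two-variable inequality at
      \<open>u = m x t\<close> and \<open>v = ?v\<close>.\<close>
    have "(\<integral>t. ((h (m x t) - h ?v) / deriv h ?v - (f (m x t) - f ?v) / deriv f ?v) \<partial>\<mu>) \<ge> 0"
      using vi pf(2,3) by (intro integral_nonneg_AE AE_I2) simp
    then have "sgn (quasi_arithmetic_mean I h m \<mu> x - ?v) \<ge> 0"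
      unfolding sgn_quasi_arithmetic_mean_diff(2)[OF I f h \<mu>(1) means' x]
      by (simp only: zero_le_sgn_iff)
    then show ?thesis by simp
  qed
  have iii_iv: "deriv (deriv f) x0 / deriv f x0 \<le> deriv (deriv h) x0 / deriv h x0"
    if iii: "\<forall>x\<^sub>0\<in>I. \<exists>U\<subseteq>I. x\<^sub>0 \<in> interior U \<and>
       (\<forall>x\<in>cube U. quasi_arithmetic_mean I f m \<mu>\<^sub>0 x \<le> quasi_arithmetic_mean I h m \<mu>\<^sub>0 x)"
      and x0: "x0 \<in> I" for x0
  proof -
    obtain U where U: "U \<subseteq> I" "x0 \<in> interior U"
        "\<And>x. x \<in> cube U \<Longrightarrow> quasi_arithmetic_mean I f m \<mu>\<^sub>0 x \<le> quasi_arithmetic_mean I h m \<mu>\<^sub>0 x"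
      using iii x0 by metis
    obtain i where i: "\<not> (\<exists>c. AE t in \<mu>\<^sub>0. partial (e i) (\<lambda>x. m x t) (vec x0) = c)"
      using assms(13) x0 by blast
    have "vec x0 \<in> cube I" using x0 by (simp add: cube_def)
    then have diff: "partially_differentiable_at (e i) (\<lambda>x. m x t) (vec x0)"
      if "t \<in> space \<mu>\<^sub>0" for t
      using C2[OF that] unfolding twice_continuously_partially_differentiable_on_def by blast
    show ?thesis
      by (rule local_comparison_imp_deriv_ratio_le[OF I f h assms(10) means x0 diff i U])
  qed
  have v_vi: "(\<forall>u\<in>I. \<forall>v\<in>I. (f u - f v) / deriv f v \<le> (h u - h v) / deriv h v) \<longleftrightarrow>
    (strict_mono_on I h \<longrightarrow> convex_on (f ` I) (h \<circ> inv_into I f)) \<and>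
    (strict_antimono_on I h \<longrightarrow> concave_on (f ` I) (h \<circ> inv_into I f))"
    by (rule tangent_inequality_iff_convex_concave[OF assms(1-3) f h])
  show ?thesis (is "all_equivalent [?i, ?ii, ?iii, ?iv, ?v, ?vi]")
  proof -
    \<comment> \<open>The implications close the cycle iv, vi, i, ii, iii, iv; assertion (v) is
      attached through \<open>v_vi\<close>. From (ii) to (iii) the open set \<open>I\<close> itself
      serves as the neighbourhood.\<close>
    have "?iv \<Longrightarrow> ?vi" using iv_vi by blast
    moreover have "?vi \<Longrightarrow> ?i" using vi_i by blast
    moreover have "?i \<Longrightarrow> ?ii" using assms(10,11) by blast
    moreover have "?ii \<Longrightarrow> ?iii"
      using interior_open[OF assms(1)] by (metis order_refl)
    moreover have "?iii \<Longrightarrow> ?iv" using iii_iv by blast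
    ultimately have "?i \<longleftrightarrow> ?vi" "?ii \<longleftrightarrow> ?vi" "?iii \<longleftrightarrow> ?vi" "?iv \<longleftrightarrow> ?vi" by argo+
    with v_vi show ?thesis
      unfolding all_equivalent_def by (simp only: list.set ball_simps) simp
  qed
qed

end
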